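(* There does not exist any sequence $\{\alpha_n\}_{n\in\mathbb{N}}$ of real numbers such that $$\big(L_{(-n,-\frac{n}{2},-\alpha_n)}\phi_n\big)(x,y,t)=\big(L_{(-n,-\frac{n}{2},-\alpha_n)}\phi_n\big)(-x,-y,-t)\qquad\text{for all }(x,y,t)\in\mathbb{H}$$ holds for all integers $n\geq 2$, where $\phi_n$ is the $n$-th order $B$-spline on the Heisenberg group $\mathbb{H}$ and $L$ denotes left translation on $\mathbb{H}$.
   Context: The Heisenberg group $\mathbb{H}$ is $\mathbb{R}^3$ with the group law $(x,y,t)(x',y',t')=(x+x',\,y+y',\,t+t'+\tfrac12(x'y-y'x))$, so that $(x,y,t)^{-1}=(-x,-y,-t)$; Haar measure is Lebesgue measure $dx\,dy\,dt$ on $\mathbb{R}^3$. For $f,g\in L^1(\mathbb{H})$, the convolution is $(f*g)(x,y,t)=\int_{\mathbb{H}}f\big((x,y,t)(u,v,s)^{-1}\big)g(u,v,s)\,du\,dv\,ds$. The $B$-splines on $\mathbb{H}$ are $\phi_1=\frac{1}{\sqrt2}\chi_{[0,2]\times[0,1]\times[0,1]}$ and, for $n\ge1$, $\phi_{n+1}=\phi_n*\phi_1$, defined pointwise by the convolution integral (so $\phi_n$ is the $n$-fold convolution of $\phi_1$). For $(u,v,s)\in\mathbb{H}$, the left translation operator is $L_{(u,v,s)}f(x,y,t)=f\big((u,v,s)^{-1}(x,y,t)\big)$. *)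

theory Defs
  imports "HOL-Analysis.Analysis"
begin

type_synonym heis = "real \<times> real \<times> real"

fun heis_mult :: "heis \<Rightarrow> heis \<Rightarrow> heis" where
  "heis_mult (x, y, t) (x', y', t') = (x + x', y + y', t + t' + (x' * y - y' * x) / 2)"

fun heis_inv :: "heis \<Rightarrow> heis" where
  "heis_inv (x, y, t) = (- x, - y, - t)"

lemma heis_mult_assoc: "heis_mult (heis_mult p q) r = heis_mult p (heis_mult q r)"
  by (cases p; cases q; cases r) (simp add: field_simps)

lemma heis_mult_zero: "heis_mult (0, 0, 0) p = p" "heis_mult p (0, 0, 0) = p"
  by (cases p; simp)+

lemma heis_mult_inv: "heis_mult (heis_inv p) p = (0, 0, 0)" "heis_mult p (heis_inv p) = (0, 0, 0)"
  by (cases p; simp)+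

text \<open>The measure \<^term>\<open>lborel :: heis measure\<close> is the product Lebesgue measure on the Borel
  sets of three-dimensional space, which is a Haar measure for the group law above. The integral is
  the Bochner integral, so it is \<^term>\<open>0\<close> by convention where the integrand is not integrable; this
  does not occur for the bounded, compactly supported Borel functions below.\<close>

definition heis_conv :: "(heis \<Rightarrow> real) \<Rightarrow> (heis \<Rightarrow> real) \<Rightarrow> heis \<Rightarrow> real" where
  "heis_conv f g p = (\<integral>q. f (heis_mult p (heis_inv q)) * g q \<partial>lborel)"

definition heis_translate :: "heis \<Rightarrow> (heis \<Rightarrow> real) \<Rightarrow> heis \<Rightarrow> real" where
  "heis_translate q f p = f (heis_mult (heis_inv q) p)"

definition heis_bspline_one :: "heis \<Rightarrow> real" where
  "heis_bspline_one p = 1 / sqrt 2 * indicator ({0..2} \<times> {0..1} \<times> {0..1}) p"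

text \<open>The order of a spline starts at \<^term>\<open>1::nat\<close>; the value at order \<^term>\<open>0::nat\<close> is a dummy.\<close>

fun heis_bspline :: "nat \<Rightarrow> heis \<Rightarrow> real" where
  "heis_bspline 0 = (\<lambda>_. 0)"
| "heis_bspline (Suc 0) = heis_bspline_one"
| "heis_bspline (Suc (Suc n)) = heis_conv (heis_bspline (Suc n)) heis_bspline_one"

end

theory Submission
  imports Defs
begin

text \<open>Order two already fails. The function \<^term>\<open>heis_bspline 2\<close> at a point is half the measure
  of the overlap of the box with a sheared reflected copy of itself, and the shear depends on the
  horizontal coordinates. Over \<open>(1, 1)\<close> the support in the central direction is therefore an interval
  of length at most 3, while over the opposite point \<open>(3, 1)\<close> it has length 4. The claimed symmetry
  would map one of these supports onto the other by a reflection.\<close>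

abbreviation heis_box :: "heis set" where
  "heis_box \<equiv> {0..2} \<times> {0..1} \<times> {0..1}"

definition heis_overlap :: "heis \<Rightarrow> heis set" where
  "heis_overlap p = {q \<in> heis_box. heis_mult p (heis_inv q) \<in> heis_box}"

lemma mem_heis_overlap:
  "(u, v, s) \<in> heis_overlap (x, y, t) \<longleftrightarrow>
    u \<in> {0..2} \<and> v \<in> {0..1} \<and> s \<in> {0..1} \<and> x - u \<in> {0..2} \<and> y - v \<in> {0..1} \<and>
    t - s + (v * x - u * y) / 2 \<in> {0..1}"
  by (auto simp: heis_overlap_def)

text \<open>Compactness supplies both Borel measurability and finite measure of the overlap.\<close>

lemma compact_heis_overlap: "compact (heis_overlap p)"
proof -
  obtain x y t where p: "p = (x, y, t)" by (cases p)
  have eq: "heis_mult p (heis_inv q) =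
      (x - fst q, y - fst (snd q), t - snd (snd q) + (fst (snd q) * x - fst q * y) / 2)" for q
    by (cases q) (simp add: p)
  have "continuous_on UNIV (\<lambda>q. heis_mult p (heis_inv q))"
    unfolding eq by (intro continuous_intros) auto
  moreover have "closed heis_box"
    by (intro closed_Times closed_atLeastAtMost)
  ultimately have "closed ((\<lambda>q. heis_mult p (heis_inv q)) -` heis_box)"
    by (simp add: closed_vimage)
  moreover have "compact heis_box"
    by (intro compact_Times compact_Icc)
  moreover have "heis_overlap p = heis_box \<inter> (\<lambda>q. heis_mult p (heis_inv q)) -` heis_box"
    by (auto simp: heis_overlap_def)
  ultimately show ?thesis
    by (simp add: compact_Int_closed)
qed

lemma heis_bspline_two: "heis_bspline 2 p = measure lborel (heis_overlap p) / 2"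
proof -
  have integrand: "heis_bspline_one (heis_mult p (heis_inv q)) * heis_bspline_one q =
      indicator (heis_overlap p) q / 2" for q
    by (auto simp: heis_bspline_one_def heis_overlap_def indicator_def)
  have "heis_bspline 2 p = (\<integral>q. indicator (heis_overlap p) q / 2 \<partial>lborel)"
    by (simp only: numeral_2_eq_2 heis_bspline.simps heis_conv_def integrand)
  also have "\<dots> = measure lborel (heis_overlap p) / 2"
    using compact_heis_overlap[of p] by (simp add: borel_compact)
  finally show ?thesis .
qed

lemma heis_bspline_two_nonzeroI:
  assumes "cbox (a, b, c) (a', b', c') \<subseteq> heis_overlap p" "a < a'" "b < b'" "c < c'"
  shows "heis_bspline 2 p \<noteq> 0"
proof -
  have "0 < measure lborel (cbox (a, b, c) (a', b', c'))"
    using assms(2-4) by (intro content_pos_lt) (auto simp: Basis_prod_def)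
  \<comment> \<open>Finiteness matters here: \<open>measure\<close> is 0 on sets of infinite
    measure.\<close>
  also have "\<dots> \<le> measure lborel (heis_overlap p)"
    using assms(1) compact_heis_overlap[of p]
    by (intro measure_mono_fmeasurable) (auto intro: fmeasurable_compact)
  finally show ?thesis
    by (simp add: heis_bspline_two)
qed

text \<open>A point of the overlap has u and v in [0, 1], so the shear (v - u) / 2 lies in
  [-1/2, 1/2], and t is a sum of two numbers from [0, 1] minus this shear.\<close>

lemma heis_bspline_two_support_1_1:
  assumes "heis_bspline 2 (1, 1, t) \<noteq> 0"
  shows "t \<in> {- 1 / 2..5 / 2}"
proof -
  have "heis_overlap (1, 1, t) \<noteq> {}"
    using assms by (auto simp: heis_bspline_two)
  then obtain u v s where "(u, v, s) \<in> heis_overlap (1, 1, t)"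
    by auto
  then show ?thesis
    by (auto simp: mem_heis_overlap field_simps)
qed

text \<open>Here u is in [1, 2] and v in [0, 1], so the shear (3 v - u) / 2 fills [-1, 1] and t can
  range over [-1, 3]. The two heights lie inside this range, more than 3 apart.\<close>

lemma heis_bspline_two_3_1_nonzero:
  shows "heis_bspline 2 (3, 1, - 3 / 4) \<noteq> 0" "heis_bspline 2 (3, 1, 11 / 4) \<noteq> 0"
proof -
  \<comment> \<open>A small box at the corner (1, 1, 0), where the shear attains its maximum
    1.\<close>
  have "cbox (1, 9 / 10, 0) (11 / 10, 1, 1 / 20) \<subseteq> heis_overlap (3, 1, - 3 / 4)"
    by (auto simp: mem_heis_overlap cbox_Pair_eq field_simps)
  then show "heis_bspline 2 (3, 1, - 3 / 4) \<noteq> 0"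
    by (rule heis_bspline_two_nonzeroI) auto
  \<comment> \<open>The opposite corner (2, 0, 1), where the shear is -1.\<close>
  have "cbox (19 / 10, 0, 19 / 20) (2, 1 / 10, 1) \<subseteq> heis_overlap (3, 1, 11 / 4)"
    by (auto simp: mem_heis_overlap cbox_Pair_eq field_simps)
  then show "heis_bspline 2 (3, 1, 11 / 4) \<noteq> 0"
    by (rule heis_bspline_two_nonzeroI) auto
qed

theorem theorem6p1:
  "\<not> (\<exists>\<alpha> :: nat \<Rightarrow> real. \<forall>n\<ge>2. \<forall>x y t :: real.
      heis_translate (- real n, - (real n / 2), - \<alpha> n) (heis_bspline n) (x, y, t) =
      heis_translate (- real n, - (real n / 2), - \<alpha> n) (heis_bspline n) (- x, - y, - t))"
proof
  assume "\<exists>\<alpha> :: nat \<Rightarrow> real. \<forall>n\<ge>2. \<forall>x y t :: real.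
      heis_translate (- real n, - (real n / 2), - \<alpha> n) (heis_bspline n) (x, y, t) =
      heis_translate (- real n, - (real n / 2), - \<alpha> n) (heis_bspline n) (- x, - y, - t)"
  then obtain \<alpha> :: "nat \<Rightarrow> real" where sym: "\<And>x y t.
      heis_translate (- real 2, - (real 2 / 2), - \<alpha> 2) (heis_bspline 2) (x, y, t) =
      heis_translate (- real 2, - (real 2 / 2), - \<alpha> 2) (heis_bspline 2) (- x, - y, - t)"
    by blast
  have reflect: "heis_bspline 2 (3, 1, r) = heis_bspline 2 (1, 1, 2 * \<alpha> 2 - r)" for r
    \<comment> \<open>The translation takes (1, 0, t) to (3, 1, \<open>\<alpha> 2\<close> + t + 1/2)
      and (-1, 0, -t) to (1, 1, \<open>\<alpha> 2\<close> - t - 1/2); t is chosen to make the first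
      height r.\<close>
    using sym[of 1 0 "r - \<alpha> 2 - 1 / 2"] by (simp add: heis_translate_def)
  \<comment> \<open>These numbers differ by 7/2, but the interval has length 3.\<close>
  have "2 * \<alpha> 2 - (- 3 / 4) \<in> {- 1 / 2..5 / 2}" "2 * \<alpha> 2 - 11 / 4 \<in> {- 1 / 2..5 / 2}"
    using heis_bspline_two_3_1_nonzero[unfolded reflect]
    by (auto dest!: heis_bspline_two_support_1_1 simp del: atLeastAtMost_iff)
  then show False
    by simp
qed

end
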